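(* Let $p\ge1$, $M\ge1$, $\varrho>0$, $\lambda>0$, and let $P_{\rm nc}(z)=\sum_{j=1}^p p_{\lambda,a}(|z_j|)$ for $z\in\mathbb{R}^p$, where $p_{\lambda,a}$ is either the MCP penalty with $a>1$ (in which case put $\kappa=1/a$) or the SCAD penalty with $a>2$ (in which case put $\kappa=1/(a-1)$). If $M\varrho>\kappa$, then for every $\bar v\in\mathbb{R}^p$ the function $$z\mapsto P_{\rm nc}(z)+\frac{M\varrho}{2}\|z-\bar v\|^2$$ is strongly convex on $\mathbb{R}^p$. Hence the coordinator update $z^{+}=\arg\min_{z}\{P_{\rm nc}(z)+\frac{M\varrho}{2}\|z-\bar v\|^2\}$ is single-valued and can be evaluated coordinatewise, i.e. $z^+_j$ is the unique minimizer over $t\in\mathbb{R}$ of $p_{\lambda,a}(|t|)+\frac{M\varrho}{2}(t-\bar v_j)^2$ for each $j$.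
   Context: For $t\ge0$, the minimax concave penalty (MCP) is $p_{\lambda,a}^{\rm MCP}(t)=\lambda t-t^2/(2a)$ for $0\le t\le a\lambda$ and $=a\lambda^2/2$ for $t>a\lambda$. The smoothly clipped absolute deviation (SCAD) penalty is $p_{\lambda,a}^{\rm SCAD}(t)=\lambda t$ for $0\le t\le\lambda$, $=\dfrac{-t^2+2a\lambda t-\lambda^2}{2(a-1)}$ for $\lambda<t\le a\lambda$, and $=\dfrac{(a+1)\lambda^2}{2}$ for $t>a\lambda$. The norm is Euclidean. *)

theory Defs
  imports "HOL-Analysis.Analysis"
begin

text \<open>Both penalties are only meant for arguments \<open>t \<ge> 0\<close>; for negative \<open>t\<close> the first branch
  gives an irrelevant value. They are always applied to absolute values below.\<close>

definition mcp :: "real \<Rightarrow> real \<Rightarrow> real \<Rightarrow> real" where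
  "mcp lam a t = (if t \<le> a * lam then lam * t - t\<^sup>2 / (2 * a) else a * lam\<^sup>2 / 2)"

definition scad :: "real \<Rightarrow> real \<Rightarrow> real \<Rightarrow> real" where
  "scad lam a t =
    (if t \<le> lam then lam * t
     else if t \<le> a * lam then (- t\<^sup>2 + 2 * a * lam * t - lam\<^sup>2) / (2 * (a - 1))
     else (a + 1) * lam\<^sup>2 / 2)"

definition P_nc :: "(real \<Rightarrow> real) \<Rightarrow> real ^ 'n \<Rightarrow> real" where
  "P_nc pen z = (\<Sum>j\<in>UNIV. pen \<bar>z $ j\<bar>)"

definition strongly_convex_on :: "'a::real_normed_vector set \<Rightarrow> ('a \<Rightarrow> real) \<Rightarrow> bool" where
  "strongly_convex_on S f \<longleftrightarrow> convex S \<and>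
    (\<exists>\<mu>>0. \<forall>x\<in>S. \<forall>y\<in>S. \<forall>t\<in>{0..1}.
       f ((1 - t) *\<^sub>R x + t *\<^sub>R y)
         \<le> (1 - t) * f x + t * f y - \<mu> / 2 * t * (1 - t) * (norm (x - y))\<^sup>2)"

definition coordinator_objective ::
    "(real \<Rightarrow> real) \<Rightarrow> nat \<Rightarrow> real \<Rightarrow> real ^ 'n \<Rightarrow> real ^ 'n \<Rightarrow> real" where
  "coordinator_objective pen M \<rho> v z = P_nc pen z + real M * \<rho> / 2 * (norm (z - v))\<^sup>2"

definition coordinate_objective ::
    "(real \<Rightarrow> real) \<Rightarrow> nat \<Rightarrow> real \<Rightarrow> real \<Rightarrow> real \<Rightarrow> real" where
  "coordinate_objective pen M \<rho> w t = pen \<bar>t\<bar> + real M * \<rho> / 2 * (t - w)\<^sup>2"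

end

theory Submission
  imports Defs
begin

text \<open>
  On \<open>[0, \<infinity>)\<close> the function \<open>s \<mapsto> pen s + \<kappa>/2 s\<^sup>2\<close> is a sum of an affine function and squared
  positive parts of affine functions, so it extends to a convex function \<open>h\<close> on the whole line.
  Since \<open>h 0 = 0\<close> and \<open>h \<ge> 0\<close> on \<open>[0, \<infinity>)\<close>, \<open>h\<close> is nondecreasing there and \<open>t \<mapsto> h \<bar>t\<bar>\<close> is convex.
  Replacing \<open>\<kappa>/2 t\<^sup>2\<close> by \<open>c/2 (t - w)\<^sup>2\<close> with \<open>c > \<kappa>\<close> gives strong convexity with
  modulus \<open>c - \<kappa>\<close> in each coordinate. The objective on the product space is the sum of the
  coordinate objectives, which are strongly convex, continuous and coercive.
\<close>

lemma convex_on_pos_part: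
  assumes "convex_on S f"
  shows "convex_on S (\<lambda>x. max 0 (f x))"
proof (rule convex_onI)
  show "convex S" using assms by (rule convex_on_imp_convex)
  fix t :: real and x y assume t: "0 < t" "t < 1" and "x \<in> S" "y \<in> S"
  then have "f ((1 - t) *\<^sub>R x + t *\<^sub>R y) \<le> (1 - t) * f x + t * f y"
    by (intro convex_onD[OF assms]) auto
  also have "\<dots> \<le> (1 - t) * max 0 (f x) + t * max 0 (f y)"
    using t by (intro add_mono mult_left_mono) auto
  finally show "max 0 (f ((1 - t) *\<^sub>R x + t *\<^sub>R y))
      \<le> (1 - t) * max 0 (f x) + t * max 0 (f y)"
    using t by simp
qed

text \<open>Squaring is convex and nondecreasing on nonnegative reals, so it preserves the convexity
  of a nonnegative function.\<close>

lemma convex_on_power2_nonneg: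
  assumes "convex_on S f" and nonneg: "\<And>x. x \<in> S \<Longrightarrow> 0 \<le> f x"
  shows "convex_on S (\<lambda>x. (f x)\<^sup>2)"
proof (rule convex_onI)
  show "convex S" using assms(1) by (rule convex_on_imp_convex)
  fix t :: real and x y assume t: "0 < t" "t < 1" and xy: "x \<in> S" "y \<in> S"
  have "(1 - t) *\<^sub>R x + t *\<^sub>R y \<in> S"
    using \<open>convex S\<close> t xy by (simp add: convex_alt)
  moreover have "f ((1 - t) *\<^sub>R x + t *\<^sub>R y) \<le> (1 - t) * f x + t * f y"
    using t xy by (intro convex_onD[OF assms(1)]) auto
  ultimately have "(f ((1 - t) *\<^sub>R x + t *\<^sub>R y))\<^sup>2 \<le> ((1 - t) * f x + t * f y)\<^sup>2"
    by (intro power_mono nonneg)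
  also have "\<dots> \<le> (1 - t) * (f x)\<^sup>2 + t * (f y)\<^sup>2"
    using convex_onD[OF convex_power2, of t "f x" "f y"] t by simp
  finally show "(f ((1 - t) *\<^sub>R x + t *\<^sub>R y))\<^sup>2 \<le> (1 - t) * (f x)\<^sup>2 + t * (f y)\<^sup>2" .
qed

lemma convex_on_affine: "convex_on UNIV (\<lambda>s::real. m * s + b)"
  by (rule convex_onI) (auto simp: algebra_simps)

text \<open>Truncated quadratics, active on one side of a knot only, correct the affine piece of a
  penalty beyond its range of validity.\<close>

lemma convex_on_pos_part_affine_power2:
  "convex_on UNIV (\<lambda>s::real. (max 0 (m * s + b))\<^sup>2)"
  by (intro convex_on_power2_nonneg convex_on_pos_part convex_on_affine) simp

lemma convex_on_compose_abs:
  fixes h :: "real \<Rightarrow> real"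
  assumes h: "convex_on UNIV h" and h0: "h 0 = 0" and nonneg: "\<And>s. 0 \<le> s \<Longrightarrow> 0 \<le> h s"
  shows "convex_on UNIV (\<lambda>x. h \<bar>x\<bar>)"
proof (rule convex_onI)
  have mono: "h r \<le> h s" if "0 \<le> r" "r \<le> s" for r s
  proof (cases "s = 0")
    case False
    then have s: "s > 0" and q: "0 \<le> r / s" "r / s \<le> 1" using that by auto
    \<comment> \<open>The point \<open>r\<close> is the convex combination of 0 and \<open>s\<close>
      with weight \<open>r / s\<close>, and \<open>h 0 = 0\<close> removes the first
      endpoint.\<close>
    have "h r \<le> r / s * h s"
      using convex_onD[OF h, of "r / s" 0 s] q s by (simp add: h0)
    also have "\<dots> \<le> h s" using q nonneg[of s] s by (intro mult_left_le_one_le) auto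
    finally show ?thesis .
  qed (use that in simp)
  fix t x y :: real assume t: "0 < t" "t < 1"
  have "h \<bar>(1 - t) *\<^sub>R x + t *\<^sub>R y\<bar> \<le> h ((1 - t) * \<bar>x\<bar> + t * \<bar>y\<bar>)"
  proof (rule mono)
    show "\<bar>(1 - t) *\<^sub>R x + t *\<^sub>R y\<bar> \<le> (1 - t) * \<bar>x\<bar> + t * \<bar>y\<bar>"
      using abs_triangle_ineq[of "(1 - t) * x" "t * y"] t by (simp add: abs_mult)
  qed simp
  also have "\<dots> \<le> (1 - t) * h \<bar>x\<bar> + t * h \<bar>y\<bar>"
    using convex_onD[OF h, of t "\<bar>x\<bar>" "\<bar>y\<bar>"] t by simp
  finally show "h \<bar>(1 - t) *\<^sub>R x + t *\<^sub>R y\<bar> \<le> (1 - t) * h \<bar>x\<bar> + t * h \<bar>y\<bar>" .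
qed simp

lemma mcp_nonneg:
  assumes "0 < lam" "0 < a" "0 \<le> t"
  shows "0 \<le> mcp lam a t"
proof (cases "t \<le> a * lam")
  case True
  then have "t * t \<le> t * (2 * a * lam)"
    using assms by (intro mult_left_mono) (auto simp: mult_pos_pos order.trans[of t "a * lam"])
  then show ?thesis
    using True assms by (simp add: mcp_def power2_eq_square field_simps)
qed (use assms in \<open>simp add: mcp_def\<close>)

lemma scad_nonneg:
  assumes "0 < lam" "1 < a" "0 \<le> t"
  shows "0 \<le> scad lam a t"
proof -
  have "0 \<le> - t\<^sup>2 + 2 * a * lam * t - lam\<^sup>2" if "lam < t" "t \<le> a * lam"
  proof -
    \<comment> \<open>The product \<open>a * lam * t\<close> dominates both squares, so twice it
      dominates their sum.\<close>
    have "lam * lam \<le> (a * lam) * t" using that assms by (intro mult_mono) auto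
    moreover have "t * t \<le> (a * lam) * t" using that assms by (intro mult_right_mono) auto
    ultimately show ?thesis by (simp add: power2_eq_square algebra_simps)
  qed
  then show ?thesis using assms by (auto simp: scad_def)
qed

lemma mcp_plus_quadratic_convex:
  assumes "0 < lam" "0 < a"
  shows "convex_on UNIV (\<lambda>x. mcp lam a \<bar>x\<bar> + 1 / a / 2 * x\<^sup>2)"
proof -
  \<comment> \<open>Adding s^2/(2a) cancels the concave term up to the knot \<open>a * lam\<close>
    and leaves \<open>lam * s\<close>; beyond the knot, completing the square gives the excess (s -
    a lam)^2/(2a). The \<open>+ 0\<close> and \<open>1 *\<close> match the shape
    \<open>m * s + b\<close>.\<close>
  define h where "h s = (lam * s + 0) + (max 0 (1 * s + - (a * lam)))\<^sup>2 / (2 * a)" for s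
  have h_eq: "h s = mcp lam a s + 1 / a / 2 * s\<^sup>2" for s
    using assms by (auto simp: h_def mcp_def max_def field_simps power2_eq_square)
  have "convex_on UNIV h"
    unfolding h_def using assms
    by (intro convex_on_add convex_on_cdiv convex_on_affine convex_on_pos_part_affine_power2) auto
  moreover have "h 0 = 0" using assms by (simp add: h_eq mcp_def)
  moreover have "0 \<le> h s" if "0 \<le> s" for s
    using mcp_nonneg[of lam a s] that assms by (simp add: h_eq)
  ultimately have "convex_on UNIV (\<lambda>x. h \<bar>x\<bar>)" by (rule convex_on_compose_abs)
  then show ?thesis by (simp add: h_eq)
qed

lemma scad_plus_quadratic_convex:
  assumes "0 < lam" "1 < a"
  shows "convex_on UNIV (\<lambda>x. scad lam a \<bar>x\<bar> + 1 / (a - 1) / 2 * x\<^sup>2)"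
proof -
  \<comment> \<open>The affine term is the middle branch after cancellation of its square. Scaled by
    2(a - 1), the other branches exceed it by (lam - s)^2 on the left and (s - a lam)^2 on the
    right.\<close>
  define h where "h s = ((2 * a * lam * s + - lam\<^sup>2)
      + ((max 0 ((-1) * s + lam))\<^sup>2 + (max 0 (1 * s + - (a * lam)))\<^sup>2)) / (2 * (a - 1))" for s
  have less: "lam < a * lam" using assms by simp
  have h_eq: "h s = scad lam a s + 1 / (a - 1) / 2 * s\<^sup>2" for s
  proof -
    have "2 * (a - 1) * h s = 2 * (a - 1) * (scad lam a s) + s\<^sup>2"
    proof -
      \<comment> \<open>Each case locates \<open>s\<close> relative to both knots, which decides
        both positive parts.\<close>
      consider "s \<le> lam" "s < a * lam" | "lam < s" "s \<le> a * lam" | "a * lam < s" "lam < s"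
        using less by linarith
      then show ?thesis
        using assms
        by cases (simp_all add: h_def scad_def power2_diff power_mult_distrib,
            simp_all add: algebra_simps power2_eq_square)
    qed
    then show ?thesis using assms by (simp add: field_simps)
  qed
  have "convex_on UNIV h"
    unfolding h_def using assms
    by (intro convex_on_add convex_on_cdiv convex_on_affine convex_on_pos_part_affine_power2) auto
  moreover have "h 0 = 0" using assms by (simp add: h_eq scad_def)
  moreover have "0 \<le> h s" if "0 \<le> s" for s
    using scad_nonneg[of lam a s] that assms by (simp add: h_eq)
  ultimately have "convex_on UNIV (\<lambda>x. h \<bar>x\<bar>)" by (rule convex_on_compose_abs)
  then show ?thesis by (simp add: h_eq)
qed

lemma coordinate_objective_strong_convexity:
  assumes conv: "convex_on UNIV (\<lambda>x. pen \<bar>x\<bar> + \<kappa> / 2 * x\<^sup>2)" and t: "0 \<le> t" "t \<le> 1"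
  shows "coordinate_objective pen M \<rho> w ((1 - t) * x + t * y)
    \<le> (1 - t) * coordinate_objective pen M \<rho> w x + t * coordinate_objective pen M \<rho> w y
      - (real M * \<rho> - \<kappa>) / 2 * t * (1 - t) * (x - y)\<^sup>2"
proof -
  define q where "q s = real M * \<rho> / 2 * (s - w)\<^sup>2 - \<kappa> / 2 * s\<^sup>2" for s
  have split: "coordinate_objective pen M \<rho> w s = (pen \<bar>s\<bar> + \<kappa> / 2 * s\<^sup>2) + q s" for s
    by (simp add: coordinate_objective_def q_def)
  \<comment> \<open>For a quadratic with second derivative \<open>real M * \<rho> - \<kappa>\<close>
    the strong convexity inequality is an identity.\<close>
  have "q ((1 - t) * x + t * y)
      = (1 - t) * q x + t * q y - (real M * \<rho> - \<kappa>) / 2 * t * (1 - t) * (x - y)\<^sup>2"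
    unfolding q_def by (simp add: power2_eq_square field_simps)
  then show ?thesis
    using convex_onD[OF conv t, of x y] unfolding split by (simp add: algebra_simps)
qed

lemma coordinate_objective_has_minimizer:
  assumes conv: "convex_on UNIV (\<lambda>x. pen \<bar>x\<bar> + \<kappa> / 2 * x\<^sup>2)"
    and nonneg: "\<And>s. 0 \<le> s \<Longrightarrow> 0 \<le> pen s" and c: "0 < real M * \<rho>"
  shows "\<exists>t. \<forall>s. coordinate_objective pen M \<rho> w t \<le> coordinate_objective pen M \<rho> w s"
proof -
  let ?f = "coordinate_objective pen M \<rho> w"
  \<comment> \<open>Finite convex functions on the line are continuous, so continuity follows
    without inspecting the branches of the penalty.\<close>
  have "continuous_on UNIV (\<lambda>x. pen \<bar>x\<bar> + \<kappa> / 2 * x\<^sup>2)"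
    using conv by (intro convex_on_continuous) auto
  then have "continuous_on UNIV (\<lambda>x. (pen \<bar>x\<bar> + \<kappa> / 2 * x\<^sup>2) - \<kappa> / 2 * x\<^sup>2)"
    by (rule continuous_on_diff) (intro continuous_intros)
  then have "continuous_on UNIV (\<lambda>x. pen \<bar>x\<bar>)" by simp
  then have cont: "continuous_on UNIV ?f"
    unfolding coordinate_objective_def by (intro continuous_intros)
  \<comment> \<open>At distance \<open>R\<close> from \<open>w\<close> the quadratic term alone
    equals \<open>?f w\<close>. As the penalty is nonnegative, no point outside the ball beats the
    centre.\<close>
  define R where "R = sqrt (2 * ?f w / (real M * \<rho>))"
  have fw: "0 \<le> ?f w" using nonneg by (simp add: coordinate_objective_def)
  have "0 \<le> R" using fw c by (simp add: R_def)
  then have "\<exists>t\<in>cball w R. \<forall>s\<in>cball w R. ?f t \<le> ?f s"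
    by (intro continuous_attains_inf continuous_on_subset[OF cont]) auto
  then obtain t where t: "\<And>s. s \<in> cball w R \<Longrightarrow> ?f t \<le> ?f s"
    by blast
  have "?f t \<le> ?f s" for s
  proof (cases "s \<in> cball w R")
    case False
    then have "R \<le> \<bar>s - w\<bar>" by (simp add: dist_real_def)
    then have "R\<^sup>2 \<le> (s - w)\<^sup>2" using \<open>0 \<le> R\<close> by (simp add: abs_le_square_iff[symmetric])
    moreover have "R\<^sup>2 = 2 * ?f w / (real M * \<rho>)" using fw c by (simp add: R_def)
    ultimately have "?f w \<le> real M * \<rho> / 2 * (s - w)\<^sup>2"
      using c by (simp add: pos_divide_le_eq mult.commute)
    also have "\<dots> \<le> ?f s" using nonneg by (simp add: coordinate_objective_def)
    finally show ?thesis using t[of w] \<open>0 \<le> R\<close> by simp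
  qed (rule t)
  then show ?thesis by blast
qed

lemma coordinator_objective_eq_sum:
  "coordinator_objective pen M \<rho> v z
    = (\<Sum>j\<in>UNIV. coordinate_objective pen M \<rho> (v $ j) (z $ j))"
proof -
  have "(norm (z - v))\<^sup>2 = (\<Sum>j\<in>UNIV. (z $ j - v $ j)\<^sup>2)"
    by (simp add: norm_vec_def L2_set_def sum_nonneg)
  then show ?thesis
    by (simp add: coordinator_objective_def coordinate_objective_def P_nc_def
        sum.distrib sum_distrib_left)
qed

text \<open>The coordinatewise gaps add up to the squared norm, so the modulus
  \<open>real M * \<rho> - \<kappa>\<close> does not depend on the dimension.\<close>

lemma coordinator_objective_strongly_convex:
  fixes v :: "real ^ 'n"
  assumes conv: "convex_on UNIV (\<lambda>x. pen \<bar>x\<bar> + \<kappa> / 2 * x\<^sup>2)" and "\<kappa> < real M * \<rho>"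
  shows "strongly_convex_on UNIV (coordinator_objective pen M \<rho> v)"
  unfolding strongly_convex_on_def
proof (intro conjI exI[of _ "real M * \<rho> - \<kappa>"] ballI)
  fix x y :: "real ^ 'n" and t :: real assume t: "t \<in> {0..1}"
  let ?f = "\<lambda>j. coordinate_objective pen M \<rho> (v $ j)"
  let ?k = "(real M * \<rho> - \<kappa>) / 2 * t * (1 - t)"
  have norm: "(norm (x - y))\<^sup>2 = (\<Sum>j\<in>UNIV. (x $ j - y $ j)\<^sup>2)"
    by (simp add: norm_vec_def L2_set_def sum_nonneg)
  have "coordinator_objective pen M \<rho> v ((1 - t) *\<^sub>R x + t *\<^sub>R y)
      = (\<Sum>j\<in>UNIV. ?f j ((1 - t) * x $ j + t * y $ j))"
    by (simp add: coordinator_objective_eq_sum)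
  also have "\<dots> \<le> (\<Sum>j\<in>UNIV. (1 - t) * ?f j (x $ j) + t * ?f j (y $ j)
      - ?k * (x $ j - y $ j)\<^sup>2)"
    using t by (intro sum_mono coordinate_objective_strong_convexity[OF conv]) auto
  also have "\<dots> = (1 - t) * coordinator_objective pen M \<rho> v x
      + t * coordinator_objective pen M \<rho> v y - ?k * (norm (x - y))\<^sup>2"
    by (simp only: norm coordinator_objective_eq_sum sum.distrib sum_subtractf sum_distrib_left)
  finally show "coordinator_objective pen M \<rho> v ((1 - t) *\<^sub>R x + t *\<^sub>R y)
      \<le> (1 - t) * coordinator_objective pen M \<rho> v x
        + t * coordinator_objective pen M \<rho> v y - ?k * (norm (x - y))\<^sup>2" .
qed (use assms in auto)

lemma strongly_convex_on_minimizer_unique: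
  assumes "strongly_convex_on S f" "x \<in> S" "y \<in> S"
    and x: "\<And>z. z \<in> S \<Longrightarrow> f x \<le> f z" and y: "\<And>z. z \<in> S \<Longrightarrow> f y \<le> f z"
  shows "x = y"
proof -
  obtain \<mu> where \<mu>: "0 < \<mu>" and S: "convex S"
    and sc: "\<And>t. t \<in> {0..1} \<Longrightarrow> f ((1 - t) *\<^sub>R x + t *\<^sub>R y)
      \<le> (1 - t) * f x + t * f y - \<mu> / 2 * t * (1 - t) * (norm (x - y))\<^sup>2"
    using assms(1-3) unfolding strongly_convex_on_def by blast
  have "(1 - 1 / 2) *\<^sub>R x + (1 / 2) *\<^sub>R y \<in> S"
    using S assms(2,3) by (intro convexD_alt) auto
  then have "f x \<le> f ((1 - 1 / 2) *\<^sub>R x + (1 / 2) *\<^sub>R y)" by (rule x)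
  \<comment> \<open>At the midpoint, two distinct minimizers would be undercut by a positive
    amount.\<close>
  also have "\<dots> \<le> f x - \<mu> / 8 * (norm (x - y))\<^sup>2"
    using sc[of "1 / 2"] y[OF \<open>x \<in> S\<close>] by simp
  finally have "\<mu> / 8 * (norm (x - y))\<^sup>2 \<le> 0" by simp
  then show ?thesis using \<mu> by (simp add: mult_le_0_iff)
qed

theorem proposition4:
  fixes M :: nat and \<rho> lam a \<kappa> :: real
    and pen :: "real \<Rightarrow> real"
    and v :: "real ^ 'n"
  assumes "M \<ge> 1" and "\<rho> > 0" and "lam > 0"
    and "(pen = mcp lam a \<and> a > 1 \<and> \<kappa> = 1 / a) \<or>
         (pen = scad lam a \<and> a > 2 \<and> \<kappa> = 1 / (a - 1))"
    and "real M * \<rho> > \<kappa>"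
  shows "strongly_convex_on UNIV (coordinator_objective pen M \<rho> v)
    \<and> (\<exists>!z. is_arg_min (coordinator_objective pen M \<rho> v) (\<lambda>_. True) z)
    \<and> (\<forall>z. is_arg_min (coordinator_objective pen M \<rho> v) (\<lambda>_. True) z \<longrightarrow>
         (\<forall>j t. is_arg_min (coordinate_objective pen M \<rho> (v $ j)) (\<lambda>_. True) t \<longleftrightarrow> t = z $ j))"
proof -
  let ?F = "coordinator_objective pen M \<rho> v"
  let ?f = "\<lambda>j. coordinate_objective pen M \<rho> (v $ j)"
  have conv: "convex_on UNIV (\<lambda>x. pen \<bar>x\<bar> + \<kappa> / 2 * x\<^sup>2)"
    using assms(3,4) mcp_plus_quadratic_convex[of lam a] scad_plus_quadratic_convex[of lam a]
    by auto
  have nonneg: "0 \<le> pen s" if "0 \<le> s" for s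
    using assms(3,4) that mcp_nonneg[of lam a s] scad_nonneg[of lam a s] by auto
  have c: "0 < real M * \<rho>" using assms(1,2) by simp
  have sc: "strongly_convex_on UNIV ?F"
    using conv assms(5) by (rule coordinator_objective_strongly_convex)
  have unique: "x = y" if "\<And>z. ?F x \<le> ?F z" "\<And>z. ?F y \<le> ?F z" for x y
    using strongly_convex_on_minimizer_unique[OF sc] that by simp
  have sum_min: "?F x \<le> ?F z" if "\<And>j s. ?f j (x $ j) \<le> ?f j s" for x z
    unfolding coordinator_objective_eq_sum by (intro sum_mono that)
  have "\<exists>t. \<forall>s. ?f j t \<le> ?f j s" for j
    by (rule coordinate_objective_has_minimizer[OF conv _ c]) (rule nonneg)
  then obtain m where m: "\<And>j s. ?f j (m j) \<le> ?f j s" by metis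
  \<comment> \<open>By separability, the vector of coordinate minimizers minimizes the whole
    sum.\<close>
  define zm :: "real ^ 'n" where "zm = (\<chi> j. m j)"
  have zm: "?f j (zm $ j) \<le> ?f j s" for j s using m by (simp add: zm_def)
  have arg_min_iff: "is_arg_min ?F (\<lambda>_. True) z \<longleftrightarrow> z = zm" for z
    unfolding is_arg_min_linorder using unique[of z zm] sum_min[OF zm] by auto
  have "is_arg_min (?f j) (\<lambda>_. True) t \<longleftrightarrow> t = zm $ j" for j t
  proof
    assume "is_arg_min (?f j) (\<lambda>_. True) t"
    then have t: "?f j t \<le> ?f j s" for s by (simp add: is_arg_min_linorder)
    \<comment> \<open>Replacing one entry of \<open>zm\<close> by another coordinate minimizer
      \<open>t\<close> yields a global minimizer again, so uniqueness in the product space forces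
      uniqueness in each coordinate.\<close>
    define z where "z = (\<chi> i. if i = j then t else zm $ i)"
    have "?F z \<le> ?F z'" for z'
      by (rule sum_min) (use t zm in \<open>simp add: z_def\<close>)
    then have "z = zm" using unique sum_min[OF zm] by blast
    then have "z $ j = zm $ j" by simp
    then show "t = zm $ j" by (simp add: z_def)
  qed (use zm in \<open>simp add: is_arg_min_linorder\<close>)
  then show ?thesis using sc by (simp add: arg_min_iff)
qed

end
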